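(* Let $(G,\cdot_G,\rhd_G,\Phi_G)$ be a twisted post-group with sub-adjacent operation $\circ_G$, and let $1_G$ be the identity of $(G,\cdot_G)$. Then: (a) $(G,\circ_G)$ is a semigroup. (b) For any $a\in G$, $a\circ_G e_a=a$, $a\circ_G a^{\dagger}=e_a$, and $\Phi_G(e_a)=1_G$. (c) The left multiplication $L^{\rhd_G}$, $a\mapsto L_a^{\rhd_G}$, is a semigroup action of $(G,\circ_G)$ on the group $(G,\cdot_G)$. (d) If $F:(G,\cdot_G,\rhd_G,\Phi_G)\to(H,\cdot_H,\rhd_H,\Phi_H)$ is a twisted post-group homomorphism, then $F$ induces a semigroup homomorphism from $(G,\circ_G)$ to $(H,\circ_H)$.
   Context: A (left) twisted post-group $(G,\cdot,\rhd,\Phi)$ is a group $(G,\cdot)$ with maps $\rhd:G\times G\to G$ and $\Phi:G\to G$ such that, setting $a\circ b=\Phi(a)\cdot(a\rhd b)$ (the sub-adjacent operation), for all $a,b,c\in G$: (1) $L_a^{\rhd}:G\to G$, $L_a^{\rhd}(b)=a\rhd b$, is a group automorphism of $(G,\cdot)$; (2) $(a\circ b)\rhd c=a\rhd(b\rhd c)$; (3) $\Phi(a\circ b)=a\circ\Phi(b)$. For $a\in G$ put $e_a=(L_a^{\rhd})^{-1}(\Phi(a)^{-1}\cdot a)$ and $a^{\dagger}=(L_a^{\rhd})^{-1}(\Phi(a)^{-1}\cdot e_a)$, where inverses of elements are taken in $(G,\cdot)$. A homomorphism of twisted post-groups from $(G,\cdot_G,\rhd_G,\Phi_G)$ to $(H,\cdot_H,\rhd_H,\Phi_H)$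 is a map $F:G\to H$ with $F(a\cdot_G b)=F(a)\cdot_H F(b)$, $F(a\rhd_G b)=F(a)\rhd_H F(b)$ and $F(\Phi_G(a))=\Phi_H(F(a))$ for all $a,b\in G$. *)

theory Defs
  imports "HOL-Algebra.Bij"
begin

record 'a twisted_post_group = "'a monoid" +
  tri :: "['a, 'a] \<Rightarrow> 'a" (infixr \<open>\<rhd>\<index>\<close> 75)
  twist :: "'a \<Rightarrow> 'a" (\<open>\<Phi>\<index>\<close>)

definition sub_adj :: "('a, 'm) twisted_post_group_scheme \<Rightarrow> 'a \<Rightarrow> 'a \<Rightarrow> 'a"
    (infixl \<open>\<odot>\<index>\<close> 70)
  where "a \<odot>\<^bsub>G\<^esub> b = \<Phi>\<^bsub>G\<^esub> a \<otimes>\<^bsub>G\<^esub> (a \<rhd>\<^bsub>G\<^esub> b)"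

text \<open>Restricted to the carrier because \<^const>\<open>auto\<close> and \<^const>\<open>AutoGroup\<close> consist of
  extensional functions.\<close>

definition left_mult :: "('a, 'm) twisted_post_group_scheme \<Rightarrow> 'a \<Rightarrow> 'a \<Rightarrow> 'a"
  where "left_mult G a = (\<lambda>b \<in> carrier G. a \<rhd>\<^bsub>G\<^esub> b)"

locale twisted_post_group = group G for G (structure) +
  assumes twist_closed: "\<Phi> \<in> carrier G \<rightarrow> carrier G"
    and left_mult_auto: "a \<in> carrier G \<Longrightarrow> left_mult G a \<in> auto G"
    and sub_adj_tri:
      "\<lbrakk>a \<in> carrier G; b \<in> carrier G; c \<in> carrier G\<rbrakk> \<Longrightarrow> (a \<odot> b) \<rhd> c = a \<rhd> (b \<rhd> c)"
    and twist_sub_adj: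
      "\<lbrakk>a \<in> carrier G; b \<in> carrier G\<rbrakk> \<Longrightarrow> \<Phi> (a \<odot> b) = a \<odot> \<Phi> b"

definition right_unit :: "('a, 'm) twisted_post_group_scheme \<Rightarrow> 'a \<Rightarrow> 'a"
  where "right_unit G a =
    inv_into (carrier G) (left_mult G a) (inv\<^bsub>G\<^esub> (\<Phi>\<^bsub>G\<^esub> a) \<otimes>\<^bsub>G\<^esub> a)"

definition dagger :: "('a, 'm) twisted_post_group_scheme \<Rightarrow> 'a \<Rightarrow> 'a"
  where "dagger G a =
    inv_into (carrier G) (left_mult G a) (inv\<^bsub>G\<^esub> (\<Phi>\<^bsub>G\<^esub> a) \<otimes>\<^bsub>G\<^esub> right_unit G a)"

definition twisted_post_group_hom ::
    "('a, 'm) twisted_post_group_scheme \<Rightarrow> ('b, 'n) twisted_post_group_scheme \<Rightarrow> ('a \<Rightarrow> 'b) set"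
  where "twisted_post_group_hom G H =
    {F \<in> hom G H.
      (\<forall>a \<in> carrier G. \<forall>b \<in> carrier G. F (a \<rhd>\<^bsub>G\<^esub> b) = F a \<rhd>\<^bsub>H\<^esub> F b) \<and>
      (\<forall>a \<in> carrier G. F (\<Phi>\<^bsub>G\<^esub> a) = \<Phi>\<^bsub>H\<^esub> (F a))}"

text \<open>Semigroups on a carrier set. They are represented by the record type \<^typ>\<open>'a monoid\<close>, so
  that \<^const>\<open>hom\<close>, which refers only to carrier and multiplication, is the set of semigroup
  homomorphisms; the field \<^const>\<open>one\<close> is irrelevant and left unspecified below.\<close>

locale carrier_semigroup =
  fixes S (structure)
  assumes m_closed: "\<lbrakk>x \<in> carrier S; y \<in> carrier S\<rbrakk> \<Longrightarrow> x \<otimes> y \<in> carrier S"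
    and m_assoc: "\<lbrakk>x \<in> carrier S; y \<in> carrier S; z \<in> carrier S\<rbrakk>
      \<Longrightarrow> (x \<otimes> y) \<otimes> z = x \<otimes> (y \<otimes> z)"

definition sub_adjacent :: "('a, 'm) twisted_post_group_scheme \<Rightarrow> 'a monoid"
  where "sub_adjacent G = \<lparr>carrier = carrier G, mult = sub_adj G, one = undefined\<rparr>"

text \<open>Action of a semigroup on a group by group automorphisms.\<close>

locale semigroup_action_on_group = carrier_semigroup S + A?: group A
  for S (structure) and A (structure) +
  fixes \<phi>
  assumes action_hom: "\<phi> \<in> hom S (AutoGroup A)"

end

theory Submission
  imports Defs
begin

text \<open>
  The identities for \<open>e\<^sub>a\<close> and \<open>a\<^sup>\<dagger>\<close> come from solving equations for \<open>\<odot>\<close>. Since \<open>a \<odot> b = \<Phi> a \<otimes> (a \<rhd> b)\<close> and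
  \<open>a \<rhd> _\<close> is bijective, the equation \<open>a \<odot> x = c\<close> has the solution
  \<open>(L\<^sub>a)\<^sup>-\<^sup>1 (inv (\<Phi> a) \<otimes> c)\<close>; the elements \<^const>\<open>right_unit\<close> and \<^const>\<open>dagger\<close> are its cases
  \<open>c = a\<close> and \<open>c = e\<^sub>a\<close>, which gives \<open>a \<odot> e\<^sub>a = a\<close> and \<open>a \<odot> a\<^sup>\<dagger> = e\<^sub>a\<close>. Applying \<open>\<Phi>\<close> to
  \<open>a \<odot> e\<^sub>a = a\<close> gives \<open>\<Phi> a \<otimes> (a \<rhd> \<Phi> e\<^sub>a) = \<Phi> a\<close>, so \<open>a \<rhd> \<Phi> e\<^sub>a = \<one>\<close>, and the injective
  endomorphism \<open>a \<rhd> _\<close> sends only \<open>\<one>\<close> to \<open>\<one>\<close>.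

  Associativity uses all three axioms: both \<open>(a \<odot> b) \<odot> c\<close> and \<open>a \<odot> (b \<odot> c)\<close> are
  \<open>\<Phi> a \<otimes> (a \<rhd> \<Phi> b) \<otimes> (a \<rhd> (b \<rhd> c))\<close>. The action law is the axiom on \<open>(a \<odot> b) \<rhd> c\<close> read as an
  equation between automorphisms, and a homomorphism preserves \<open>\<odot>\<close> because \<open>\<odot>\<close> is a term in the
  operations that it preserves.
\<close>

context twisted_post_group
begin

lemma tri_hom: "a \<in> carrier G \<Longrightarrow> left_mult G a \<in> hom G G"
  using left_mult_auto by (simp add: auto_def)

lemma tri_bij: "a \<in> carrier G \<Longrightarrow> bij_betw (left_mult G a) (carrier G) (carrier G)"
  using left_mult_auto by (auto simp: auto_def Bij_def)

lemma twist_mem [simp]: "a \<in> carrier G \<Longrightarrow> \<Phi> a \<in> carrier G"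
  using twist_closed by blast

lemma tri_closed [simp]:
  assumes "a \<in> carrier G" "b \<in> carrier G"
  shows "a \<rhd> b \<in> carrier G"
  using hom_in_carrier[OF tri_hom[OF assms(1)] assms(2)] assms by (simp add: left_mult_def)

lemma tri_mult:
  assumes "a \<in> carrier G" "b \<in> carrier G" "c \<in> carrier G"
  shows "a \<rhd> (b \<otimes> c) = (a \<rhd> b) \<otimes> (a \<rhd> c)"
  using hom_mult[OF tri_hom[OF assms(1)] assms(2,3)] assms by (simp add: left_mult_def)

lemma tri_eq_one:
  assumes "a \<in> carrier G" "b \<in> carrier G" "a \<rhd> b = \<one>"
  shows "b = \<one>"
proof -
  have "left_mult G a \<one> = \<one>"
    using hom_one[OF tri_hom[OF assms(1)]] is_group by simp
  then have "left_mult G a b = left_mult G a \<one>"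
    using assms by (simp add: left_mult_def)
  then show ?thesis
    using inj_onD[OF bij_betw_imp_inj_on[OF tri_bij[OF assms(1)]]] assms(2) one_closed
    by blast
qed

lemma sub_adj_closed [simp]:
  "\<lbrakk>a \<in> carrier G; b \<in> carrier G\<rbrakk> \<Longrightarrow> a \<odot> b \<in> carrier G"
  by (simp add: sub_adj_def)

lemma sub_adj_assoc:
  assumes "a \<in> carrier G" "b \<in> carrier G" "c \<in> carrier G"
  shows "(a \<odot> b) \<odot> c = a \<odot> (b \<odot> c)"
proof -
  have "(a \<odot> b) \<odot> c = \<Phi> (a \<odot> b) \<otimes> ((a \<odot> b) \<rhd> c)"
    by (simp add: sub_adj_def)
  also have "\<dots> = (a \<odot> \<Phi> b) \<otimes> (a \<rhd> (b \<rhd> c))"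
    using assms by (simp add: twist_sub_adj sub_adj_tri)
  also have "\<dots> = \<Phi> a \<otimes> (a \<rhd> (\<Phi> b \<otimes> (b \<rhd> c)))"
    using assms by (simp add: sub_adj_def tri_mult m_assoc)
  also have "\<dots> = a \<odot> (b \<odot> c)"
    by (simp add: sub_adj_def)
  finally show ?thesis .
qed

text \<open>Left translation by \<open>\<Phi> a\<close> and \<open>a \<rhd> _\<close> are both bijections of the carrier, so \<open>a \<odot> _\<close> can be
  inverted by undoing them in turn. The preimage has the form in which it occurs in
  \<^const>\<open>right_unit\<close> and \<^const>\<open>dagger\<close>, so that both are instances.\<close>

lemma sub_adj_solution:
  fixes a c
  defines "x \<equiv> inv_into (carrier G) (left_mult G a) (inv (\<Phi> a) \<otimes> c)"
  assumes a: "a \<in> carrier G" and c: "c \<in> carrier G"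
  shows "x \<in> carrier G" and "a \<odot> x = c"
proof -
  have im: "inv (\<Phi> a) \<otimes> c \<in> left_mult G a ` carrier G"
    using tri_bij[OF a] a c by (simp add: bij_betw_def)
  show x: "x \<in> carrier G"
    unfolding x_def using im by (rule inv_into_into)
  have "left_mult G a x = inv (\<Phi> a) \<otimes> c"
    unfolding x_def using im by (rule f_inv_into_f)
  then have "a \<rhd> x = inv (\<Phi> a) \<otimes> c"
    using x by (simp add: left_mult_def)
  then show "a \<odot> x = c"
    using a c by (simp add: sub_adj_def m_assoc[symmetric])
qed

lemma right_unit_closed: "a \<in> carrier G \<Longrightarrow> right_unit G a \<in> carrier G"
  by (simp add: right_unit_def sub_adj_solution(1))

lemma sub_adj_right_unit: "a \<in> carrier G \<Longrightarrow> a \<odot> right_unit G a = a"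
  by (simp add: right_unit_def sub_adj_solution(2))

lemma sub_adj_dagger: "a \<in> carrier G \<Longrightarrow> a \<odot> dagger G a = right_unit G a"
  by (simp add: dagger_def right_unit_closed sub_adj_solution(2))

lemma twist_right_unit:
  assumes a: "a \<in> carrier G"
  shows "\<Phi> (right_unit G a) = \<one>"
proof -
  let ?e = "right_unit G a"
  have e: "?e \<in> carrier G"
    using a by (rule right_unit_closed)
  have "\<Phi> a \<otimes> (a \<rhd> \<Phi> ?e) = \<Phi> (a \<odot> ?e)"
    using twist_sub_adj[OF a e] by (simp add: sub_adj_def)
  then have "\<Phi> a \<otimes> (a \<rhd> \<Phi> ?e) = \<Phi> a"
    using a by (simp add: sub_adj_right_unit)
  then have "a \<rhd> \<Phi> ?e = \<one>"
    using a e by simp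
  with a twist_mem[OF e] show ?thesis
    by (rule tri_eq_one)
qed

lemma carrier_semigroup_sub_adjacent: "carrier_semigroup (sub_adjacent G)"
  by unfold_locales (simp_all add: sub_adjacent_def sub_adj_assoc)

lemma left_mult_sub_adj:
  assumes "a \<in> carrier G" "b \<in> carrier G"
  shows "left_mult G (a \<odot> b) = compose (carrier G) (left_mult G a) (left_mult G b)"
  using assms by (auto simp: left_mult_def compose_def sub_adj_tri)

lemma left_mult_hom: "left_mult G \<in> hom (sub_adjacent G) (AutoGroup G)"
proof (rule homI)
  fix a b
  assume "a \<in> carrier (sub_adjacent G)" "b \<in> carrier (sub_adjacent G)"
  then have ab: "a \<in> carrier G" "b \<in> carrier G"
    by (simp_all add: sub_adjacent_def)
  show "left_mult G a \<in> carrier (AutoGroup G)"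
    using left_mult_auto[OF ab(1)] by (simp add: AutoGroup_def)
  have "left_mult G a \<in> Bij (carrier G)" "left_mult G b \<in> Bij (carrier G)"
    using ab left_mult_auto by (auto simp: auto_def)
  then show "left_mult G (a \<otimes>\<^bsub>sub_adjacent G\<^esub> b)
      = left_mult G a \<otimes>\<^bsub>AutoGroup G\<^esub> left_mult G b"
    using ab by (simp add: sub_adjacent_def AutoGroup_def BijGroup_def left_mult_sub_adj)
qed

lemma semigroup_action_left_mult:
  "semigroup_action_on_group (sub_adjacent G) G (left_mult G)"
  by (intro semigroup_action_on_group.intro semigroup_action_on_group_axioms.intro
      carrier_semigroup_sub_adjacent is_group left_mult_hom)

lemma twisted_post_group_hom_sub_adjacent:
  assumes F: "F \<in> twisted_post_group_hom G H"
  shows "F \<in> hom (sub_adjacent G) (sub_adjacent H)"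
proof (rule homI)
  have hom: "F \<in> hom G H"
    using F by (simp add: twisted_post_group_hom_def)
  fix a b
  assume "a \<in> carrier (sub_adjacent G)" "b \<in> carrier (sub_adjacent G)"
  then have ab: "a \<in> carrier G" "b \<in> carrier G"
    by (simp_all add: sub_adjacent_def)
  show "F a \<in> carrier (sub_adjacent H)"
    using hom_in_carrier[OF hom ab(1)] by (simp add: sub_adjacent_def)
  have "F (a \<odot> b) = F (\<Phi> a) \<otimes>\<^bsub>H\<^esub> F (a \<rhd> b)"
    using hom_mult[OF hom] ab by (simp add: sub_adj_def)
  also have "\<dots> = F a \<odot>\<^bsub>H\<^esub> F b"
    using F ab by (simp add: twisted_post_group_hom_def sub_adj_def)
  finally show "F (a \<otimes>\<^bsub>sub_adjacent G\<^esub> b) = F a \<otimes>\<^bsub>sub_adjacent H\<^esub> F b"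
    by (simp add: sub_adjacent_def)
qed

end

theorem theorem2p7:
  fixes G :: "('a, 'm) twisted_post_group_scheme"
  assumes "twisted_post_group G"
  shows "carrier_semigroup (sub_adjacent G)
    \<and> (\<forall>a \<in> carrier G. a \<odot>\<^bsub>G\<^esub> right_unit G a = a
          \<and> a \<odot>\<^bsub>G\<^esub> dagger G a = right_unit G a
          \<and> \<Phi>\<^bsub>G\<^esub> (right_unit G a) = \<one>\<^bsub>G\<^esub>)
    \<and> semigroup_action_on_group (sub_adjacent G) G (left_mult G)
    \<and> (\<forall>(H :: ('b, 'n) twisted_post_group_scheme) F.
          twisted_post_group H \<longrightarrow> F \<in> twisted_post_group_hom G H
          \<longrightarrow> F \<in> hom (sub_adjacent G) (sub_adjacent H))"
proof -
  interpret twisted_post_group G by (fact assms)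
  show ?thesis
    by (simp add: carrier_semigroup_sub_adjacent sub_adj_right_unit sub_adj_dagger
        twist_right_unit semigroup_action_left_mult twisted_post_group_hom_sub_adjacent)
qed

end
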